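(* Problem (SDIPT$_\infty$) can be solved in $O(n)$ time by the subroutine which, for given $T,n,w,u,c,K$, computes the weight vector $\bar w(e)=w(e)+\min\{K/c(e),\,u(e)-w(e)\}$ $(e\in E)$ and the corresponding value $\bar w(T)$, and outputs $[\bar w,\bar w(T)]$ as an optimal solution and its optimal value.
   Context: Let $T=(V,E)$ be a tree rooted at $s$ with node set $V=\{s,v_1,\dots,v_n\}$ and edge set $E=\{e_1,\dots,e_n\}$, and let $Y=\{t_1,\dots,t_r\}$ be its set of leaf nodes. Each edge $e$ has an original weight $w(e)$, an upper bound $u(e)$ and a unit modification cost $c(e)$, with $u(e)\ge w(e)\ge 0$ and $c(e)>0$. For $t_k\in Y$, $P_k$ is the path from $s$ to $t_k$. For an edge weight vector $x$, put $x(P_k)=\sum_{e\in P_k}x(e)$ and $x(T)=\sum_{t_k\in Y}x(P_k)$ (the sum of root-leaf distances). Given a value $K$, problem (SDIPT$_\infty$) is: maximize $\bar w(T)$ over $\bar w$ subject to $\max_{e\in E}c(e)(\bar w(e)-w(e))\le K$ and $w(e)\le\bar w(e)\le u(e)$ for all $e\in E$.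
   Formalization: The formal theorem assumes K ≥ 0 and that T has at least one edge: for K < 0 no weight vector is feasible, so the formula gives no optimal solution, and without edges the maximum over E is undefined. *)

theory Defs
  imports
    Complex_Main
    "HOL-Library.Landau_Symbols"
    "Graph_Theory.Graph_Theory"
begin

section \<open>Rooted trees and root-leaf distances\<close>

text \<open>
  A rooted tree is a finite digraph whose arcs point away from the root: every node is
  reached from the root by exactly one walk. Uniqueness among all walks, and not only among
  simple paths, excludes directed cycles, loops, parallel arcs and arcs entering the root.
\<close>

locale rooted_tree = fin_digraph T
  for T :: "('v, 'e) pre_digraph" (structure) +
  fixes s :: 'v
  assumes root_in_verts: "s \<in> verts T"
    and unique_walk: "v \<in> verts T \<Longrightarrow> \<exists>!p. awalk s p v"
begin

definition leaves :: "'v set" where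
  "leaves = {v \<in> verts T. out_arcs T v = {}}"

definition root_path :: "'v \<Rightarrow> 'e awalk" where
  "root_path v = (THE p. apath s p v)"

definition sum_root_leaf_dist :: "('e \<Rightarrow> real) \<Rightarrow> real" where
  "sum_root_leaf_dist x = (\<Sum>t\<in>leaves. awalk_cost x (root_path t))"

end

section \<open>The interdiction problem with weighted maximum norm\<close>

text \<open>
  The assumption \<^term>\<open>0 \<le> K\<close> is implicit in the problem: as \<^term>\<open>w\<close> is a lower bound on
  the feasible weights and the costs are positive, nothing is feasible for negative \<^term>\<open>K\<close>.
  The maximum over all arcs needs at least one arc.
\<close>

locale sdipt_inf = rooted_tree T s
  for T :: "('v, 'e) pre_digraph" (structure) and s :: 'v +
  fixes w u c :: "'e \<Rightarrow> real" and K :: real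
  assumes arcs_nonempty: "arcs T \<noteq> {}"
    and weight_nonneg: "e \<in> arcs T \<Longrightarrow> 0 \<le> w e"
    and weight_le_upper: "e \<in> arcs T \<Longrightarrow> w e \<le> u e"
    and cost_pos: "e \<in> arcs T \<Longrightarrow> 0 < c e"
    and budget_nonneg: "0 \<le> K"
begin

definition feasible :: "('e \<Rightarrow> real) \<Rightarrow> bool" where
  "feasible x \<longleftrightarrow>
     Max ((\<lambda>e. c e * (x e - w e)) ` arcs T) \<le> K \<and>
     (\<forall>e\<in>arcs T. w e \<le> x e \<and> x e \<le> u e)"

definition optimal_solution :: "('e \<Rightarrow> real) \<Rightarrow> bool" where
  "optimal_solution = is_arg_max sum_root_leaf_dist feasible"

definition optimal_value :: real where
  "optimal_value = (SUP x\<in>Collect feasible. sum_root_leaf_dist x)"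

end

section \<open>A real RAM\<close>

text \<open>
  Running time is measured on a unit-cost random access machine with two kinds of memory,
  for natural numbers (indices) and for real numbers, each consisting of named registers and
  named arrays. Programs are written in a while language over this memory. The only
  operation on indices is addition, and there is no conversion between the two kinds; in
  particular rounding of reals, which would make unit costs unreasonable, is not available.
\<close>

record state =
  nvar :: "string \<Rightarrow> nat"
  narr :: "string \<Rightarrow> nat \<Rightarrow> nat"
  rvar :: "string \<Rightarrow> real"
  rarr :: "string \<Rightarrow> nat \<Rightarrow> real"

datatype nexp = N nat | NV string | NA string nexp | NPlus nexp nexp

datatype rexp = R real | RV string | RA string nexp | RPlus rexp rexp | RMinus rexp rexp
  | RTimes rexp rexp | RDiv rexp rexp

datatype test = NLess nexp nexp | RLess rexp rexp

datatype com =
    NAssign string nexp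
  | NStore string nexp nexp
  | RAssign string rexp
  | RStore string nexp rexp
  | Seq com com  (infixr \<open>;;\<close> 60)
  | If test com com  (\<open>(IF _/ THEN _/ ELSE _)\<close> [0, 61, 61] 61)
  | While test com  (\<open>(WHILE _/ DO _)\<close> [0, 61] 61)

primrec nval :: "nexp \<Rightarrow> state \<Rightarrow> nat" where
  "nval (N k) \<sigma> = k"
| "nval (NV x) \<sigma> = nvar \<sigma> x"
| "nval (NA a i) \<sigma> = narr \<sigma> a (nval i \<sigma>)"
| "nval (NPlus i j) \<sigma> = nval i \<sigma> + nval j \<sigma>"

primrec rval :: "rexp \<Rightarrow> state \<Rightarrow> real" where
  "rval (R r) \<sigma> = r"
| "rval (RV x) \<sigma> = rvar \<sigma> x"
| "rval (RA a i) \<sigma> = rarr \<sigma> a (nval i \<sigma>)"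
| "rval (RPlus p q) \<sigma> = rval p \<sigma> + rval q \<sigma>"
| "rval (RMinus p q) \<sigma> = rval p \<sigma> - rval q \<sigma>"
| "rval (RTimes p q) \<sigma> = rval p \<sigma> * rval q \<sigma>"
| "rval (RDiv p q) \<sigma> = rval p \<sigma> / rval q \<sigma>"

primrec tval :: "test \<Rightarrow> state \<Rightarrow> bool" where
  "tval (NLess i j) \<sigma> \<longleftrightarrow> nval i \<sigma> < nval j \<sigma>"
| "tval (RLess p q) \<sigma> \<longleftrightarrow> rval p \<sigma> < rval q \<sigma>"

text \<open>Every constant, memory access, arithmetic operation and comparison costs one step.\<close>

primrec ncost :: "nexp \<Rightarrow> nat" where
  "ncost (N k) = 1"
| "ncost (NV x) = 1"
| "ncost (NA a i) = 1 + ncost i"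
| "ncost (NPlus i j) = 1 + ncost i + ncost j"

primrec rcost :: "rexp \<Rightarrow> nat" where
  "rcost (R r) = 1"
| "rcost (RV x) = 1"
| "rcost (RA a i) = 1 + ncost i"
| "rcost (RPlus p q) = 1 + rcost p + rcost q"
| "rcost (RMinus p q) = 1 + rcost p + rcost q"
| "rcost (RTimes p q) = 1 + rcost p + rcost q"
| "rcost (RDiv p q) = 1 + rcost p + rcost q"

primrec tcost :: "test \<Rightarrow> nat" where
  "tcost (NLess i j) = 1 + ncost i + ncost j"
| "tcost (RLess p q) = 1 + rcost p + rcost q"

definition set_nvar :: "string \<Rightarrow> nat \<Rightarrow> state \<Rightarrow> state" where
  "set_nvar x k \<sigma> = \<sigma>\<lparr>nvar := (nvar \<sigma>)(x := k)\<rparr>"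

definition set_narr :: "string \<Rightarrow> nat \<Rightarrow> nat \<Rightarrow> state \<Rightarrow> state" where
  "set_narr a i k \<sigma> = \<sigma>\<lparr>narr := (narr \<sigma>)(a := (narr \<sigma> a)(i := k))\<rparr>"

definition set_rvar :: "string \<Rightarrow> real \<Rightarrow> state \<Rightarrow> state" where
  "set_rvar x r \<sigma> = \<sigma>\<lparr>rvar := (rvar \<sigma>)(x := r)\<rparr>"

definition set_rarr :: "string \<Rightarrow> nat \<Rightarrow> real \<Rightarrow> state \<Rightarrow> state" where
  "set_rarr a i r \<sigma> = \<sigma>\<lparr>rarr := (rarr \<sigma>)(a := (rarr \<sigma> a)(i := r))\<rparr>"

text \<open>\<open>exec p \<sigma> t \<sigma>'\<close>: program \<open>p\<close> started in \<open>\<sigma>\<close> halts in \<open>\<sigma>'\<close> after exactly \<open>t\<close> steps.\<close>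

inductive exec :: "com \<Rightarrow> state \<Rightarrow> nat \<Rightarrow> state \<Rightarrow> bool" where
  NAssign: "exec (NAssign x i) \<sigma> (1 + ncost i) (set_nvar x (nval i \<sigma>) \<sigma>)"
| NStore: "exec (NStore a i j) \<sigma> (1 + ncost i + ncost j)
             (set_narr a (nval i \<sigma>) (nval j \<sigma>) \<sigma>)"
| RAssign: "exec (RAssign x p) \<sigma> (1 + rcost p) (set_rvar x (rval p \<sigma>) \<sigma>)"
| RStore: "exec (RStore a i p) \<sigma> (1 + ncost i + rcost p)
             (set_rarr a (nval i \<sigma>) (rval p \<sigma>) \<sigma>)"
| Seq: "exec p \<sigma> t \<sigma>' \<Longrightarrow> exec q \<sigma>' t' \<sigma>'' \<Longrightarrow> exec (p ;; q) \<sigma> (t + t') \<sigma>''"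
| IfTrue: "tval b \<sigma> \<Longrightarrow> exec p \<sigma> t \<sigma>' \<Longrightarrow> exec (IF b THEN p ELSE q) \<sigma> (1 + tcost b + t) \<sigma>'"
| IfFalse: "\<not> tval b \<sigma> \<Longrightarrow> exec q \<sigma> t \<sigma>' \<Longrightarrow> exec (IF b THEN p ELSE q) \<sigma> (1 + tcost b + t) \<sigma>'"
| WhileFalse: "\<not> tval b \<sigma> \<Longrightarrow> exec (WHILE b DO p) \<sigma> (1 + tcost b) \<sigma>"
| WhileTrue: "tval b \<sigma> \<Longrightarrow> exec p \<sigma> t \<sigma>' \<Longrightarrow> exec (WHILE b DO p) \<sigma>' t' \<sigma>'' \<Longrightarrow>
    exec (WHILE b DO p) \<sigma> (1 + tcost b + t + t') \<sigma>''"

inductive_cases NAssignE: "exec (NAssign x i) \<sigma> t \<sigma>'"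
inductive_cases NStoreE: "exec (NStore a i j) \<sigma> t \<sigma>'"
inductive_cases RAssignE: "exec (RAssign x p) \<sigma> t \<sigma>'"
inductive_cases RStoreE: "exec (RStore a i p) \<sigma> t \<sigma>'"
inductive_cases SeqE: "exec (p ;; q) \<sigma> t \<sigma>'"
inductive_cases IfE: "exec (IF b THEN p ELSE q) \<sigma> t \<sigma>'"
inductive_cases WhileE: "exec (WHILE b DO p) \<sigma> t \<sigma>'"

lemma exec_deterministic:
  assumes "exec p \<sigma> t \<sigma>'" and "exec p \<sigma> t' \<sigma>''"
  shows "t' = t \<and> \<sigma>'' = \<sigma>'"
  using assms
proof (induction arbitrary: t' \<sigma>'' rule: exec.induct)
  case (NAssign x i \<sigma>)
  then show ?case by (rule NAssignE) simp
next
  case (NStore a i j \<sigma>)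
  then show ?case by (rule NStoreE) simp
next
  case (RAssign x p \<sigma>)
  then show ?case by (rule RAssignE) simp
next
  case (RStore a i p \<sigma>)
  then show ?case by (rule RStoreE) simp
next
  case (Seq p \<sigma> t1 \<sigma>1 q t2 \<sigma>2)
  from Seq.prems show ?case by (rule SeqE) (auto dest!: Seq.IH)
next
  case (IfTrue b \<sigma> p t1 \<sigma>1 q)
  from IfTrue.prems show ?case by (rule IfE) (use IfTrue.hyps in \<open>auto dest!: IfTrue.IH\<close>)
next
  case (IfFalse b \<sigma> q t1 \<sigma>1 p)
  from IfFalse.prems show ?case by (rule IfE) (use IfFalse.hyps in \<open>auto dest!: IfFalse.IH\<close>)
next
  case (WhileFalse b \<sigma> p)
  from WhileFalse.prems show ?case by (rule WhileE) (use WhileFalse.hyps in simp_all)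
next
  case (WhileTrue b \<sigma> p t1 \<sigma>1 t2 \<sigma>2)
  from WhileTrue.prems WhileTrue.hyps(1) obtain ta \<sigma>a tb
    where *: "t' = Suc (tcost b + ta + tb)" "exec p \<sigma> ta \<sigma>a" "exec (WHILE b DO p) \<sigma>a tb \<sigma>''"
    by (auto elim: exec.cases)
  then have "ta = t1" "\<sigma>a = \<sigma>1"
    using WhileTrue.IH(1) by blast+
  with * show ?case
    using WhileTrue.IH(2) by auto
qed

section \<open>The algorithm\<close>

text \<open>
  Input: the root is node \<open>0\<close>, the other nodes and the arcs are numbered \<open>1, \<dots>, n\<close>, in
  no particular order. The tree is given as a list of arcs. Memory outside the input is arbitrary.
\<close>

definition sdipt_input ::
  "nat \<Rightarrow> (nat, nat) pre_digraph \<Rightarrow> (nat \<Rightarrow> real) \<Rightarrow> (nat \<Rightarrow> real) \<Rightarrow> (nat \<Rightarrow> real) \<Rightarrow> real \<Rightarrow>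
    state \<Rightarrow> bool" where
  "sdipt_input n T w u c K \<sigma> \<longleftrightarrow>
     verts T = {0..n} \<and> arcs T = {1..n} \<and>
     nvar \<sigma> ''n'' = n \<and> rvar \<sigma> ''K'' = K \<and>
     (\<forall>e\<in>{1..n}.
        narr \<sigma> ''tail'' e = tail T e \<and> narr \<sigma> ''head'' e = head T e \<and>
        rarr \<sigma> ''w'' e = w e \<and> rarr \<sigma> ''u'' e = u e \<and> rarr \<sigma> ''c'' e = c e)"

text \<open>
  The first two loops compute the new weights and, for every node, the linked list
  \<open>first\<close>, \<open>next\<close> of its outgoing arcs, terminated by \<open>0\<close>. A breadth-first search from the root
  then computes the distances of all nodes and sums those of the leaves.
\<close>

definition init_lists :: com where
  "init_lists =
     NAssign ''v'' (N 0) ;;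
     WHILE NLess (NV ''v'') (NPlus (NV ''n'') (N 1)) DO (
       NStore ''first'' (NV ''v'') (N 0) ;;
       NAssign ''v'' (NPlus (NV ''v'') (N 1)))"

definition process_arcs :: com where
  "process_arcs =
     NAssign ''e'' (N 1) ;;
     WHILE NLess (NV ''e'') (NPlus (NV ''n'') (N 1)) DO (
       (IF RLess (RDiv (RV ''K'') (RA ''c'' (NV ''e'')))
                (RMinus (RA ''u'' (NV ''e'')) (RA ''w'' (NV ''e'')))
        THEN RStore ''wbar'' (NV ''e'')
               (RPlus (RA ''w'' (NV ''e'')) (RDiv (RV ''K'') (RA ''c'' (NV ''e''))))
        ELSE RStore ''wbar'' (NV ''e'')
               (RPlus (RA ''w'' (NV ''e'')) (RMinus (RA ''u'' (NV ''e'')) (RA ''w'' (NV ''e''))))) ;;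
       NStore ''next'' (NV ''e'') (NA ''first'' (NA ''tail'' (NV ''e''))) ;;
       NStore ''first'' (NA ''tail'' (NV ''e'')) (NV ''e'') ;;
       NAssign ''e'' (NPlus (NV ''e'') (N 1)))"

definition sum_distances :: com where
  "sum_distances =
     RAssign ''value'' (R 0) ;;
     NStore ''queue'' (N 0) (N 0) ;;
     RStore ''dist'' (N 0) (R 0) ;;
     NAssign ''i'' (N 0) ;;
     NAssign ''m'' (N 1) ;;
     WHILE NLess (NV ''i'') (NV ''m'') DO (
       NAssign ''v'' (NA ''queue'' (NV ''i'')) ;;
       NAssign ''e'' (NA ''first'' (NV ''v'')) ;;
       (IF NLess (N 0) (NV ''e'')
        THEN WHILE NLess (N 0) (NV ''e'') DO (
          NStore ''queue'' (NV ''m'') (NA ''head'' (NV ''e'')) ;;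
          RStore ''dist'' (NA ''head'' (NV ''e''))
            (RPlus (RA ''dist'' (NV ''v'')) (RA ''wbar'' (NV ''e''))) ;;
          NAssign ''m'' (NPlus (NV ''m'') (N 1)) ;;
          NAssign ''e'' (NA ''next'' (NV ''e'')))
        ELSE RAssign ''value'' (RPlus (RV ''value'') (RA ''dist'' (NV ''v'')))) ;;
       NAssign ''i'' (NPlus (NV ''i'') (N 1)))"

definition sdipt_algorithm :: com where
  "sdipt_algorithm = init_lists ;; process_arcs ;; sum_distances"

definition output_weights :: "state \<Rightarrow> nat \<Rightarrow> real" where
  "output_weights \<sigma> = rarr \<sigma> ''wbar''"

definition output_value :: "state \<Rightarrow> real" where
  "output_value \<sigma> = rvar \<sigma> ''value''"

end

(*
  Feasibility decouples over the arcs: x is feasible iff w e <= x e <= w e + min (K / c e) (u e - w e)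
  for every arc e. As the sum of root-leaf distances is monotone in every weight, the pointwise
  largest feasible vector is optimal. The search is linear because every node other than the root
  is the head of exactly one arc, so each arc is scanned once and each node is enqueued once; the
  time of the nested loops is bounded with the potential 40 (n + 1 - m) + 60 (n + 1 - i), where m
  nodes have been enqueued and i of them expanded.
*)

theory Submission
  imports Defs
begin

section \<open>Walks in rooted trees\<close>

context rooted_tree
begin

text \<open>\<open>root_path\<close> selects a simple path, whereas uniqueness is assumed for walks.
  Every walk contracts to a simple path and every simple path is a walk, so both single out
  \<open>p\<close>.\<close>

lemma root_path_eq:
  assumes "awalk s p v"
  shows "root_path v = p"
proof -
  have v: "v \<in> verts T" using assms by blast
  have "apath s (awalk_to_apath p) v" using assms by (rule apath_awalk_to_apath)
  moreover have "\<And>q. apath s q v \<Longrightarrow> q = p"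
    using unique_walk[OF v] assms awalkI_apath by blast
  ultimately show ?thesis unfolding root_path_def by (metis theI)
qed

lemma awalk_root_path:
  assumes "v \<in> verts T"
  shows "awalk s (root_path v) v"
  using unique_walk[OF assms] root_path_eq by blast

lemma awalk_snoc:
  assumes "awalk a p (tail T e)" and "e \<in> arcs T"
  shows "awalk a (p @ [e]) (head T e)"
  using assms arc_implies_awalk[OF assms(2)] by (meson awalk_appendI)

lemma root_path_head:
  assumes "e \<in> arcs T"
  shows "root_path (head T e) = root_path (tail T e) @ [e]"
  using assms by (intro root_path_eq awalk_snoc awalk_root_path) auto

lemma root_path_root: "root_path s = []"
  using root_in_verts by (intro root_path_eq) (simp add: awalk_Nil_iff)

text \<open>The root path of a head ends in an arc, while that of the root is empty.\<close>

lemma head_neq_root: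
  assumes "e \<in> arcs T"
  shows "head T e \<noteq> s"
  using root_path_head[OF assms] root_path_root by auto

text \<open>The last arc of the root path to \<open>head T e\<close> is \<open>e\<close> itself.
  This is why the search can do without marking visited nodes.\<close>

lemma inj_on_head: "inj_on (head T) (arcs T)"
  by (rule inj_onI) (metis root_path_head append1_eq_conv)

text \<open>Serves to show that the search, once its queue is exhausted, has reached the whole
  tree.\<close>

lemma closed_contains_verts:
  assumes "s \<in> S" and closed: "\<And>e. e \<in> arcs T \<Longrightarrow> tail T e \<in> S \<Longrightarrow> head T e \<in> S"
  shows "verts T \<subseteq> S"
proof
  fix v assume "v \<in> verts T"
  \<comment> \<open>The start of the walk varies, since dropping the first arc moves it.\<close>
  have "v \<in> S" if "awalk a p v" "a \<in> S" for a p
    using that by (induction p arbitrary: a) (auto simp: awalk_Nil_iff awalk_Cons_iff closed)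
  then show "v \<in> S"
    using awalk_root_path[OF \<open>v \<in> verts T\<close>] \<open>s \<in> S\<close> by blast
qed

lemma sum_root_leaf_dist_mono:
  assumes "\<And>e. e \<in> arcs T \<Longrightarrow> x e \<le> y e"
  shows "sum_root_leaf_dist x \<le> sum_root_leaf_dist y"
proof -
  have *: "awalk_cost x p \<le> awalk_cost y p" if "set p \<subseteq> arcs T" for p
    using that by (induction p) (auto intro: add_mono assms)
  show ?thesis
    unfolding sum_root_leaf_dist_def
  proof (rule sum_mono)
    fix t assume "t \<in> leaves"
    then have "awalk s (root_path t) t" by (intro awalk_root_path) (simp add: leaves_def)
    then show "awalk_cost x (root_path t) \<le> awalk_cost y (root_path t)"
      by (intro *) blast
  qed
qed

end

section \<open>The optimal weights\<close>

context sdipt_inf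
begin

text \<open>A maximum over a finite nonempty set is at most \<open>K\<close> iff every member is,
  and division by the positive cost turns this into a bound on the increase of each single
  weight.\<close>

lemma feasible_iff:
  "feasible x \<longleftrightarrow> (\<forall>e\<in>arcs T. w e \<le> x e \<and> x e \<le> w e + min (K / c e) (u e - w e))"
proof -
  have "Max ((\<lambda>e. c e * (x e - w e)) ` arcs T) \<le> K \<longleftrightarrow> (\<forall>e\<in>arcs T. c e * (x e - w e) \<le> K)"
    using arcs_nonempty by (subst Max_le_iff) auto
  also have "\<dots> \<longleftrightarrow> (\<forall>e\<in>arcs T. x e - w e \<le> K / c e)"
    by (intro ball_cong refl) (simp add: cost_pos pos_le_divide_eq mult.commute)
  finally show ?thesis
    unfolding feasible_def by (auto simp: min_le_iff_disj) (smt (verit))+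
qed

text \<open>\<open>x\<close> is prescribed on the arcs only, because the output array may hold
  anything at other indices.\<close>

lemma
  assumes x: "\<And>e. e \<in> arcs T \<Longrightarrow> x e = w e + min (K / c e) (u e - w e)"
  shows optimal_solutionI: "optimal_solution x"
    and optimal_value_eq: "optimal_value = sum_root_leaf_dist x"
proof -
  \<comment> \<open>Both arguments of the minimum are nonnegative, so the lower bound
    \<open>w\<close> is respected.\<close>
  have feas: "feasible x"
    unfolding feasible_iff
    by (auto simp: x budget_nonneg weight_le_upper less_imp_le[OF cost_pos])
  have max: "sum_root_leaf_dist y \<le> sum_root_leaf_dist x" if "feasible y" for y
    using that by (intro sum_root_leaf_dist_mono) (auto simp: feasible_iff x)
  show "optimal_solution x"
    unfolding optimal_solution_def is_arg_max_def using feas max by (auto simp: not_less)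
  show "optimal_value = sum_root_leaf_dist x"
    unfolding optimal_value_def using feas max by (intro cSup_eq_maximum) auto
qed

end

section \<open>Weakest preconditions with running time\<close>

text \<open>Total correctness: a halting run must exist, and by determinism of \<open>exec\<close>
  it is the only one. The postcondition also sees the number of steps.\<close>

definition wp :: "com \<Rightarrow> (nat \<Rightarrow> state \<Rightarrow> bool) \<Rightarrow> state \<Rightarrow> bool" where
  "wp p Q \<sigma> \<longleftrightarrow> (\<exists>t \<sigma>'. exec p \<sigma> t \<sigma>' \<and> Q t \<sigma>')"

lemma wp_mono:
  assumes "wp p Q \<sigma>" and "\<And>t \<sigma>'. Q t \<sigma>' \<Longrightarrow> Q' t \<sigma>'"
  shows "wp p Q' \<sigma>"
  using assms unfolding wp_def by blast

lemma wp_NAssign: "Q (1 + ncost i) (set_nvar x (nval i \<sigma>) \<sigma>) \<Longrightarrow> wp (NAssign x i) Q \<sigma>"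
  unfolding wp_def by (meson exec.NAssign)

lemma wp_NStore:
  "Q (1 + ncost i + ncost j) (set_narr a (nval i \<sigma>) (nval j \<sigma>) \<sigma>) \<Longrightarrow> wp (NStore a i j) Q \<sigma>"
  unfolding wp_def by (meson exec.NStore)

lemma wp_RAssign: "Q (1 + rcost p) (set_rvar x (rval p \<sigma>) \<sigma>) \<Longrightarrow> wp (RAssign x p) Q \<sigma>"
  unfolding wp_def by (meson exec.RAssign)

lemma wp_RStore:
  "Q (1 + ncost i + rcost p) (set_rarr a (nval i \<sigma>) (rval p \<sigma>) \<sigma>) \<Longrightarrow> wp (RStore a i p) Q \<sigma>"
  unfolding wp_def by (meson exec.RStore)

lemma wp_Seq: "wp p (\<lambda>t. wp q (\<lambda>t'. Q (t + t'))) \<sigma> \<Longrightarrow> wp (p ;; q) Q \<sigma>"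
  unfolding wp_def by (meson exec.Seq)

lemma wp_If:
  assumes "tval b \<sigma> \<Longrightarrow> wp p (\<lambda>t. Q (1 + tcost b + t)) \<sigma>"
    and "\<not> tval b \<sigma> \<Longrightarrow> wp q (\<lambda>t. Q (1 + tcost b + t)) \<sigma>"
  shows "wp (IF b THEN p ELSE q) Q \<sigma>"
  using assms unfolding wp_def by (meson exec.IfTrue exec.IfFalse)

text \<open>The potential \<open>\<Phi>\<close> serves as termination measure and as amortised running time.\<close>

lemma wp_While:
  fixes \<Phi> :: "state \<Rightarrow> nat"
  assumes "I \<sigma>"
    and step: "\<And>\<sigma>. I \<sigma> \<Longrightarrow> tval b \<sigma> \<Longrightarrow> wp p (\<lambda>t \<sigma>'. I \<sigma>' \<and> 1 + tcost b + t + \<Phi> \<sigma>' \<le> \<Phi> \<sigma>) \<sigma>"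
  shows "wp (WHILE b DO p) (\<lambda>t \<sigma>'. I \<sigma>' \<and> \<not> tval b \<sigma>' \<and> t + \<Phi> \<sigma>' \<le> \<Phi> \<sigma> + (1 + tcost b)) \<sigma>"
  using \<open>I \<sigma>\<close>
proof (induction "\<Phi> \<sigma>" arbitrary: \<sigma> rule: less_induct)
  case less
  show ?case
  proof (cases "tval b \<sigma>")
    \<comment> \<open>The last, failing test is not paid by the potential; it is the summand
      \<open>1 + tcost b\<close> of the bound.\<close>
    case False
    then show ?thesis
      using less.prems exec.WhileFalse[OF False] unfolding wp_def by fastforce
  next
    case True
    obtain t1 \<sigma>1 where 1: "exec p \<sigma> t1 \<sigma>1" "I \<sigma>1" "1 + tcost b + t1 + \<Phi> \<sigma>1 \<le> \<Phi> \<sigma>"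
      using step[OF less.prems True] unfolding wp_def by blast
    obtain t2 \<sigma>2 where 2: "exec (WHILE b DO p) \<sigma>1 t2 \<sigma>2" "I \<sigma>2" "\<not> tval b \<sigma>2"
      \<comment> \<open>An iteration takes at least one step, so \<open>\<Phi>\<close> is strictly
        smaller at \<open>\<sigma>1\<close> and the induction hypothesis applies.\<close>
      "t2 + \<Phi> \<sigma>2 \<le> \<Phi> \<sigma>1 + (1 + tcost b)"
      using less.hyps[of \<sigma>1] 1 unfolding wp_def by fastforce
    have "exec (WHILE b DO p) \<sigma> (1 + tcost b + t1 + t2) \<sigma>2"
      using True 1(1) 2(1) by (rule exec.WhileTrue)
    then show ?thesis
      unfolding wp_def using 1(3) 2 by (intro exI[of _ "1 + tcost b + t1 + t2"] exI[of _ \<sigma>2]) auto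
  qed
qed

text \<open>Applied backwards, these execute loop-free code symbolically. Loops are kept apart since
  they need an invariant and a potential.\<close>

lemmas wp_intros = wp_Seq wp_If wp_NAssign wp_NStore wp_RAssign wp_RStore

lemma state_access [simp]:
  "nvar (set_nvar x k \<sigma>) = (nvar \<sigma>)(x := k)"
  "narr (set_nvar x k \<sigma>) = narr \<sigma>"
  "rvar (set_nvar x k \<sigma>) = rvar \<sigma>"
  "rarr (set_nvar x k \<sigma>) = rarr \<sigma>"
  "nvar (set_narr a i k \<sigma>) = nvar \<sigma>"
  "narr (set_narr a i k \<sigma>) = (narr \<sigma>)(a := (narr \<sigma> a)(i := k))"
  "rvar (set_narr a i k \<sigma>) = rvar \<sigma>"
  "rarr (set_narr a i k \<sigma>) = rarr \<sigma>"
  "nvar (set_rvar x r \<sigma>) = nvar \<sigma>"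
  "narr (set_rvar x r \<sigma>) = narr \<sigma>"
  "rvar (set_rvar x r \<sigma>) = (rvar \<sigma>)(x := r)"
  "rarr (set_rvar x r \<sigma>) = rarr \<sigma>"
  "nvar (set_rarr a i r \<sigma>) = nvar \<sigma>"
  "narr (set_rarr a i r \<sigma>) = narr \<sigma>"
  "rvar (set_rarr a i r \<sigma>) = rvar \<sigma>"
  "rarr (set_rarr a i r \<sigma>) = (rarr \<sigma>)(a := (rarr \<sigma> a)(i := r))"
  by (simp_all add: set_nvar_def set_narr_def set_rvar_def set_rarr_def)

section \<open>Initialisation and weight computation\<close>

text \<open>Frame rules: the input survives every write to another register or array.\<close>

lemma sdipt_input_update [simp]:
  "x \<noteq> ''n'' \<Longrightarrow>
     sdipt_input n T w u c K (set_nvar x k \<sigma>) = sdipt_input n T w u c K \<sigma>"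
  "a \<noteq> ''tail'' \<Longrightarrow> a \<noteq> ''head'' \<Longrightarrow>
     sdipt_input n T w u c K (set_narr a i k \<sigma>) = sdipt_input n T w u c K \<sigma>"
  "a \<noteq> ''w'' \<Longrightarrow> a \<noteq> ''u'' \<Longrightarrow> a \<noteq> ''c'' \<Longrightarrow>
     sdipt_input n T w u c K (set_rarr a i r \<sigma>) = sdipt_input n T w u c K \<sigma>"
  by (simp_all add: sdipt_input_def)

lemma sdipt_inputD:
  assumes "sdipt_input n T w u c K \<sigma>"
  shows "nvar \<sigma> ''n'' = n" "rvar \<sigma> ''K'' = K"
    and "0 < e \<Longrightarrow> e \<le> n \<Longrightarrow> narr \<sigma> ''tail'' e = tail T e"
    and "0 < e \<Longrightarrow> e \<le> n \<Longrightarrow> rarr \<sigma> ''w'' e = w e"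
    and "0 < e \<Longrightarrow> e \<le> n \<Longrightarrow> rarr \<sigma> ''u'' e = u e"
    and "0 < e \<Longrightarrow> e \<le> n \<Longrightarrow> rarr \<sigma> ''c'' e = c e"
  using assms by (simp_all add: sdipt_input_def)

lemma wp_init_lists:
  assumes "sdipt_input n T w u c K \<sigma>"
  shows "wp init_lists (\<lambda>t \<sigma>'. t \<le> 20 * n + 40 \<and> sdipt_input n T w u c K \<sigma>' \<and>
           (\<forall>v\<le>n. narr \<sigma>' ''first'' v = 0)) \<sigma>"
proof -
  let ?I = "\<lambda>\<sigma>. sdipt_input n T w u c K \<sigma> \<and> nvar \<sigma> ''v'' \<le> n + 1 \<and>
    (\<forall>v<nvar \<sigma> ''v''. narr \<sigma> ''first'' v = 0)"
  show ?thesis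
    unfolding init_lists_def
    apply (rule wp_Seq, rule wp_NAssign)
    \<comment> \<open>An iteration with its test takes 13 steps; 20 is a rounded bound.\<close>
    apply (rule wp_mono, rule wp_While[where I = ?I and \<Phi> = "\<lambda>\<sigma>. 20 * (n + 1 - nvar \<sigma> ''v'')"])
    subgoal
      using assms by simp
    subgoal for \<sigma>'
      using sdipt_inputD(1)[of n T w u c K \<sigma>']
      by (intro wp_intros) (auto simp: less_Suc_eq)
    subgoal for t \<sigma>'
      using sdipt_inputD(1)[of n T w u c K \<sigma>'] by auto
    done
qed

section \<open>Adjacency lists: linked lists of outgoing arcs, with 0 as null pointer because arcs
  are numbered from 1\<close>

primrec linked_list :: "(nat \<Rightarrow> nat) \<Rightarrow> nat \<Rightarrow> nat list \<Rightarrow> bool" where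
  "linked_list nxt a [] \<longleftrightarrow> a = 0"
| "linked_list nxt a (x # xs) \<longleftrightarrow> a = x \<and> 0 < x \<and> linked_list nxt (nxt x) xs"

lemma linked_list_update:
  "e \<notin> set xs \<Longrightarrow> linked_list (nxt(e := k)) a xs = linked_list nxt a xs"
  by (induction xs arbitrary: a) auto

lemma linked_list_pos: "linked_list nxt a xs \<Longrightarrow> 0 < a \<Longrightarrow> \<exists>ys. xs = a # ys"
  by (cases xs) auto

text \<open>Reversed because each arc is inserted at the front. The bound \<open>m\<close> is
  exclusive: it is the next arc to be processed.\<close>

definition out_list :: "(nat, nat) pre_digraph \<Rightarrow> nat \<Rightarrow> nat \<Rightarrow> nat list" where
  "out_list T m v = rev (filter (\<lambda>e. tail T e = v) [1..<m])"

lemma set_out_list: "set (out_list T m v) = {e \<in> {1..<m}. tail T e = v}"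
  by (auto simp: out_list_def)

lemma distinct_out_list: "distinct (out_list T m v)"
  by (simp add: out_list_def)

lemma out_list_Suc:
  "0 < m \<Longrightarrow> out_list T (Suc m) v = (if tail T m = v then m # out_list T m v else out_list T m v)"
  by (auto simp: out_list_def)

definition has_out_lists :: "(nat, nat) pre_digraph \<Rightarrow> nat \<Rightarrow> nat \<Rightarrow> state \<Rightarrow> bool" where
  "has_out_lists T n m \<sigma> \<longleftrightarrow>
     (\<forall>v\<le>n. linked_list (narr \<sigma> ''next'') (narr \<sigma> ''first'' v) (out_list T m v))"

lemma has_out_lists_update [simp]:
  "has_out_lists T n m (set_nvar x k \<sigma>) = has_out_lists T n m \<sigma>"
  "has_out_lists T n m (set_rarr a i r \<sigma>) = has_out_lists T n m \<sigma>"
  by (simp_all add: has_out_lists_def)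

text \<open>Arc \<open>m\<close> is in no list yet, so redirecting its \<open>next\<close> pointer
  disturbs none. The pointer receives the old front of the list before \<open>first\<close> is
  overwritten.\<close>

lemma has_out_lists_Suc:
  assumes "has_out_lists T n m \<sigma>" and "0 < m" and "tail T m \<le> n"
  shows "has_out_lists T n (Suc m) (set_narr ''first'' (tail T m) m
    (set_narr ''next'' m (narr \<sigma> ''first'' (tail T m)) \<sigma>))"
  using assms by (simp add: has_out_lists_def out_list_Suc linked_list_update set_out_list)

lemma wp_process_arcs:
  assumes "wf_digraph T" "sdipt_input n T w u c K \<sigma>" "\<forall>v\<le>n. narr \<sigma> ''first'' v = 0"
  shows "wp process_arcs (\<lambda>t \<sigma>'. t \<le> 60 * n + 40 \<and> sdipt_input n T w u c K \<sigma>' \<and>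
           has_out_lists T n (Suc n) \<sigma>' \<and>
           (\<forall>e\<in>{1..n}. rarr \<sigma>' ''wbar'' e = w e + min (K / c e) (u e - w e))) \<sigma>"
proof -
  let ?I = "\<lambda>\<sigma>. sdipt_input n T w u c K \<sigma> \<and> 0 < nvar \<sigma> ''e'' \<and> nvar \<sigma> ''e'' \<le> n + 1 \<and>
    has_out_lists T n (nvar \<sigma> ''e'') \<sigma> \<and>
    (\<forall>e\<in>{1..<nvar \<sigma> ''e''}. rarr \<sigma> ''wbar'' e = w e + min (K / c e) (u e - w e))"
  have tail: "tail T e \<le> n" if "sdipt_input n T w u c K \<sigma>" "0 < e" "e \<le> n" for e \<sigma>
    using wf_digraph.tail_in_verts[OF assms(1), of e] that by (auto simp: sdipt_input_def)
  show ?thesis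
    unfolding process_arcs_def
  proof (rule wp_Seq, rule wp_NAssign, rule wp_mono,
      \<comment> \<open>An iteration with its test takes at most 40 steps, which 60 covers even with
        the rounded bound used below for the conditional.\<close>
      rule wp_While[where I = ?I and \<Phi> = "\<lambda>\<sigma>. 60 * (n + 1 - nvar \<sigma> ''e'')"])
    show "?I (set_nvar ''e'' (nval (N 1) \<sigma>) \<sigma>)"
      using assms by (simp add: has_out_lists_def out_list_def)
  next
    fix \<tau> :: state
    let ?e = "nvar \<tau> ''e''"
    assume I: "?I \<tau>" and "tval (NLess (NV ''e'') (NPlus (NV ''n'') (N 1))) \<tau>"
    then have e: "0 < ?e" "?e \<le> n" using sdipt_inputD(1)[of n T w u c K \<tau>] by simp_all
    note acc = sdipt_inputD[OF conjunct1[OF I]] sdipt_inputD(3-)[OF conjunct1[OF I] e]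
    note lists = has_out_lists_Suc[of T n ?e, OF _ e(1) tail[OF conjunct1[OF I] e]]
    show "wp ((IF RLess (RDiv (RV ''K'') (RA ''c'' (NV ''e'')))
                (RMinus (RA ''u'' (NV ''e'')) (RA ''w'' (NV ''e'')))
        THEN RStore ''wbar'' (NV ''e'')
               (RPlus (RA ''w'' (NV ''e'')) (RDiv (RV ''K'') (RA ''c'' (NV ''e''))))
        ELSE RStore ''wbar'' (NV ''e'')
               (RPlus (RA ''w'' (NV ''e'')) (RMinus (RA ''u'' (NV ''e'')) (RA ''w'' (NV ''e''))))) ;;
       NStore ''next'' (NV ''e'') (NA ''first'' (NA ''tail'' (NV ''e''))) ;;
       NStore ''first'' (NA ''tail'' (NV ''e'')) (NV ''e'') ;;
       NAssign ''e'' (NPlus (NV ''e'') (N 1)))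
      (\<lambda>t \<tau>'. ?I \<tau>' \<and> 1 + tcost (NLess (NV ''e'') (NPlus (NV ''n'') (N 1))) + t +
         60 * (n + 1 - nvar \<tau>' ''e'') \<le> 60 * (n + 1 - ?e)) \<tau>"
    \<comment> \<open>The conditional is summarised as one store of the minimum, so that the rest is
      executed once and not per branch. The dearer branch takes 21 steps including the test.\<close>
    proof (rule wp_Seq, rule wp_mono[where Q = "\<lambda>t \<tau>'. t \<le> 25 \<and>
          \<tau>' = set_rarr ''wbar'' ?e (w ?e + min (K / c ?e) (u ?e - w ?e)) \<tau>"])
      show "wp (IF RLess (RDiv (RV ''K'') (RA ''c'' (NV ''e'')))
                (RMinus (RA ''u'' (NV ''e'')) (RA ''w'' (NV ''e'')))
        THEN RStore ''wbar'' (NV ''e'')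
               (RPlus (RA ''w'' (NV ''e'')) (RDiv (RV ''K'') (RA ''c'' (NV ''e''))))
        ELSE RStore ''wbar'' (NV ''e'')
               (RPlus (RA ''w'' (NV ''e'')) (RMinus (RA ''u'' (NV ''e'')) (RA ''w'' (NV ''e'')))))
        (\<lambda>t \<tau>'. t \<le> 25 \<and>
          \<tau>' = set_rarr ''wbar'' ?e (w ?e + min (K / c ?e) (u ?e - w ?e)) \<tau>) \<tau>"
        by (intro wp_If wp_RStore conjI) (simp_all add: acc min_def)
    next
      fix t :: nat and \<tau>' :: state
      let ?\<rho> = "set_rarr ''wbar'' ?e (w ?e + min (K / c ?e) (u ?e - w ?e)) \<tau>"
      assume *: "t \<le> 25 \<and> \<tau>' = ?\<rho>"
      have "has_out_lists T n (Suc ?e) (set_narr ''first'' (tail T ?e) ?e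
          (set_narr ''next'' ?e (narr ?\<rho> ''first'' (tail T ?e)) ?\<rho>))"
        using I by (intro lists) simp
      then show "wp (NStore ''next'' (NV ''e'') (NA ''first'' (NA ''tail'' (NV ''e''))) ;;
         NStore ''first'' (NA ''tail'' (NV ''e'')) (NV ''e'') ;;
         NAssign ''e'' (NPlus (NV ''e'') (N 1)))
        (\<lambda>t' \<tau>'. ?I \<tau>' \<and> 1 + tcost (NLess (NV ''e'') (NPlus (NV ''n'') (N 1))) + (t + t') +
           60 * (n + 1 - nvar \<tau>' ''e'') \<le> 60 * (n + 1 - ?e)) \<tau>'"
        unfolding conjunct2[OF *]
        using I e conjunct1[OF *] by (intro wp_intros conjI) (simp_all add: acc Suc_diff_le)
    qed
  next
    fix t :: nat and \<tau> :: state
    assume *: "?I \<tau> \<and> \<not> tval (NLess (NV ''e'') (NPlus (NV ''n'') (N 1))) \<tau> \<and>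
      t + 60 * (n + 1 - nvar \<tau> ''e'') \<le>
        60 * (n + 1 - nvar (set_nvar ''e'' (nval (N 1) \<sigma>) \<sigma>) ''e'') +
        (1 + tcost (NLess (NV ''e'') (NPlus (NV ''n'') (N 1))))"
    \<comment> \<open>The failed test gives one inequality, the invariant the other.\<close>
    then have "nvar \<tau> ''e'' = Suc n" using sdipt_inputD(1)[of n T w u c K \<tau>] by simp
    then show "1 + ncost (N 1) + t \<le> 60 * n + 40 \<and> sdipt_input n T w u c K \<tau> \<and>
        has_out_lists T n (Suc n) \<tau> \<and>
        (\<forall>e\<in>{1..n}. rarr \<tau> ''wbar'' e = w e + min (K / c e) (u e - w e))"
      using * by (simp add: atLeastLessThanSuc_atLeastAtMost)
  qed
qed

section \<open>Breadth-first search\<close>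

text \<open>
  \<open>A\<close> is the set of arcs scanned so far. The queue is never emptied: it holds all
  nodes discovered so far, and the first \<open>i\<close> of them have been expanded.
\<close>

definition bfs_state ::
  "(nat, nat) pre_digraph \<Rightarrow> nat \<Rightarrow> (nat \<Rightarrow> real) \<Rightarrow> nat set \<Rightarrow> state \<Rightarrow> bool" where
  "bfs_state T n x A \<sigma> \<longleftrightarrow>
     A \<subseteq> arcs T \<and> rarr \<sigma> ''wbar'' = x \<and> has_out_lists T n (Suc n) \<sigma> \<and>
     (\<forall>e\<in>arcs T. narr \<sigma> ''head'' e = head T e) \<and>
     inj_on (narr \<sigma> ''queue'') {..<nvar \<sigma> ''m''} \<and>
     narr \<sigma> ''queue'' ` {..<nvar \<sigma> ''m''} = insert 0 (head T ` A) \<and>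
     (\<forall>v\<in>insert 0 (head T ` A). rarr \<sigma> ''dist'' v = wf_digraph.awalk_cost x (rooted_tree.root_path T 0 v)) \<and>
     rvar \<sigma> ''value'' = (\<Sum>v \<in> narr \<sigma> ''queue'' ` {..<nvar \<sigma> ''i''} \<inter> rooted_tree.leaves T.
        wf_digraph.awalk_cost x (rooted_tree.root_path T 0 v))"

text \<open>The value of \<open>A\<close> between two expansions. During an expansion the scanned
  part of the current list is added to it.\<close>

definition expanded_arcs :: "(nat, nat) pre_digraph \<Rightarrow> state \<Rightarrow> nat set" where
  "expanded_arcs T \<sigma> = {e \<in> arcs T. tail T e \<in> narr \<sigma> ''queue'' ` {..<nvar \<sigma> ''i''}}"

section \<open>Correctness and amortised running time of the search on a fixed tree\<close>

context
  fixes T :: "(nat, nat) pre_digraph" and n :: nat and x :: "nat \<Rightarrow> real"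
  assumes tree: "rooted_tree T 0" and verts: "verts T = {0..n}" and arcs: "arcs T = {1..n}"
begin

interpretation rooted_tree T 0 by (rule tree)

text \<open>The queue holds distinct nodes of the tree, of which there are \<open>n + 1\<close>.
  This keeps the subtractions in the potential from being truncated.\<close>

lemma bfs_state_queue_bound:
  assumes "bfs_state T n x A \<sigma>"
  shows "nvar \<sigma> ''m'' \<le> Suc n"
proof -
  let ?Q = "narr \<sigma> ''queue''" and ?m = "nvar \<sigma> ''m''"
  have inj: "inj_on ?Q {..<?m}"
    and "?Q ` {..<?m} = insert 0 (head T ` A)" "A \<subseteq> arcs T"
    using assms by (simp_all add: bfs_state_def)
  then have "?Q ` {..<?m} \<subseteq> {0..n}"
    unfolding verts[symmetric] using root_in_verts head_in_verts by auto
  then have "card (?Q ` {..<?m}) \<le> card {0..n}" by (intro card_mono) auto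
  then show ?thesis by (simp only: card_image[OF inj] card_lessThan card_atLeastAtMost)
qed

text \<open>Guarantees that the arcs of the next node are still unscanned and that its distance is
  not counted twice.\<close>

lemma bfs_state_next_node:
  assumes "bfs_state T n x A \<sigma>" and "nvar \<sigma> ''i'' < nvar \<sigma> ''m''"
  shows "narr \<sigma> ''queue'' (nvar \<sigma> ''i'') \<notin> narr \<sigma> ''queue'' ` {..<nvar \<sigma> ''i''}"
proof -
  have "inj_on (narr \<sigma> ''queue'') {..<nvar \<sigma> ''m''}"
    using assms(1) by (simp add: bfs_state_def)
  then show ?thesis
    using assms(2) by (subst inj_on_image_mem_iff) auto
qed

text \<open>The head of a new arc is neither the root nor the head of another arc. It is therefore a
  new node: the queue stays injective and no valid distance is overwritten.\<close>

lemma bfs_state_scan_arc: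
  assumes bfs: "bfs_state T n x A \<sigma>" and e: "e \<in> arcs T" "e \<notin> A"
    and v: "v = tail T e" "v \<in> insert 0 (head T ` A)"
    and i: "nvar \<sigma> ''i'' \<le> nvar \<sigma> ''m''"
    and m: "nvar \<sigma> ''m'' = m"
  shows "bfs_state T n x (insert e A)
    (set_nvar ''m'' (m + 1)
      (set_rarr ''dist'' (head T e) (rarr \<sigma> ''dist'' v + x e)
        (set_narr ''queue'' m (head T e) \<sigma>)))"
proof -
  have new: "head T e \<notin> insert 0 (head T ` A)"
    using bfs e inj_on_head head_neq_root by (auto simp: bfs_state_def inj_on_def)
  have Q: "narr \<sigma> ''queue'' ` {..<m} = insert 0 (head T ` A)"
    using bfs m by (simp add: bfs_state_def)
  have "inj_on (narr \<sigma> ''queue'') {..<m}"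
    using bfs m by (simp add: bfs_state_def)
  then have "inj_on ((narr \<sigma> ''queue'')(m := head T e)) {..<Suc m}"
    using new unfolding lessThan_Suc inj_on_insert Q[symmetric]
    by (intro conjI inj_on_fun_updI) (auto split: if_splits)
  moreover have "((narr \<sigma> ''queue'')(m := head T e)) ` {..<Suc m} =
      insert 0 (head T ` insert e A)"
  proof -
    have "((narr \<sigma> ''queue'')(m := head T e)) ` {..<m} = narr \<sigma> ''queue'' ` {..<m}"
      by (intro image_cong) auto
    then show ?thesis unfolding lessThan_Suc image_insert Q by auto
  qed
  \<comment> \<open>As \<open>i \<le> m\<close>, enqueuing does not touch the expanded prefix, on
    which \<open>value\<close> depends.\<close>
  moreover have "((narr \<sigma> ''queue'')(m := head T e)) ` {..<nvar \<sigma> ''i''} =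
      narr \<sigma> ''queue'' ` {..<nvar \<sigma> ''i''}"
    using i m by (intro image_cong) auto
  moreover have "rarr \<sigma> ''dist'' v + x e = awalk_cost x (root_path (head T e))"
    using bfs v e(1) by (auto simp: bfs_state_def root_path_head awalk_cost_append)
  ultimately show ?thesis
    using bfs new e by (auto simp: bfs_state_def has_out_lists_def m)
qed

text \<open>The inner loop of \<open>sum_distances\<close>, named in order to be verified on its
  own.\<close>

definition scan_arcs :: com where
  "scan_arcs =
     WHILE NLess (N 0) (NV ''e'') DO (
       NStore ''queue'' (NV ''m'') (NA ''head'' (NV ''e'')) ;;
       RStore ''dist'' (NA ''head'' (NV ''e''))
         (RPlus (RA ''dist'' (NV ''v'')) (RA ''wbar'' (NV ''e''))) ;;
       NAssign ''m'' (NPlus (NV ''m'') (N 1)) ;;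
       NAssign ''e'' (NA ''next'' (NV ''e'')))"

text \<open>Every iteration enqueues a node and takes 23 steps, paid by the 40 units of the slot
  filled. The final 10 covers the failing test. Position \<open>i\<close> is included among the
  unchanged ones because it holds the node being expanded.\<close>

lemma wp_scan_arcs:
  assumes bfs: "bfs_state T n x (expanded_arcs T \<sigma>) \<sigma>"
    and i: "nvar \<sigma> ''i'' < nvar \<sigma> ''m''"
    and v: "nvar \<sigma> ''v'' = narr \<sigma> ''queue'' (nvar \<sigma> ''i'')"
    and e: "nvar \<sigma> ''e'' = narr \<sigma> ''first'' (nvar \<sigma> ''v'')"
  shows "wp scan_arcs (\<lambda>t \<sigma>'.
    bfs_state T n x (expanded_arcs T \<sigma> \<union> {e \<in> arcs T. tail T e = nvar \<sigma> ''v''}) \<sigma>' \<and>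
    nvar \<sigma>' ''i'' = nvar \<sigma> ''i'' \<and> nvar \<sigma> ''m'' \<le> nvar \<sigma>' ''m'' \<and>
    (\<forall>j\<le>nvar \<sigma> ''i''. narr \<sigma>' ''queue'' j = narr \<sigma> ''queue'' j) \<and>
    t + 40 * (Suc n - nvar \<sigma>' ''m'') \<le> 40 * (Suc n - nvar \<sigma> ''m'') + 10) \<sigma>"
proof -
  let ?v = "nvar \<sigma> ''v''" and ?A = "expanded_arcs T \<sigma>"
  let ?L = "out_list T (Suc n) ?v"
  \<comment> \<open>\<open>ds\<close> are the arcs of the current node already scanned,
    \<open>ys\<close> those still ahead of the pointer.\<close>
  let ?inv = "\<lambda>ds ys \<tau>. ?L = ds @ ys \<and> linked_list (narr \<tau> ''next'') (nvar \<tau> ''e'') ys \<and>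
    bfs_state T n x (?A \<union> set ds) \<tau> \<and> nvar \<tau> ''v'' = ?v \<and>
    nvar \<tau> ''i'' = nvar \<sigma> ''i'' \<and> nvar \<sigma> ''m'' \<le> nvar \<tau> ''m'' \<and>
    (\<forall>j\<le>nvar \<sigma> ''i''. narr \<tau> ''queue'' j = narr \<sigma> ''queue'' j)"
  have v_disc: "?v \<in> insert 0 (head T ` ?A)"
    using bfs i unfolding v bfs_state_def by blast
  have v_le: "?v \<le> n"
    using v_disc head_in_verts verts by (auto simp: expanded_arcs_def)
  have set_L: "set ?L = {e \<in> arcs T. tail T e = ?v}"
    by (auto simp: set_out_list arcs)
  have v_new: "?v \<notin> narr \<sigma> ''queue'' ` {..<nvar \<sigma> ''i''}"
    using bfs_state_next_node[OF bfs i] v by simp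
  show ?thesis
    unfolding scan_arcs_def
  proof (rule wp_mono, rule wp_While[where I = "\<lambda>\<tau>. \<exists>ds ys. ?inv ds ys \<tau>"
        and \<Phi> = "\<lambda>\<tau>. 40 * (Suc n - nvar \<tau> ''m'')"])
    show "\<exists>ds ys. ?inv ds ys \<sigma>"
      using bfs v_le e by (intro exI[of _ "[]"] exI[of _ ?L]) (auto simp: bfs_state_def has_out_lists_def)
  next
    fix \<tau> :: state
    assume "\<exists>ds ys. ?inv ds ys \<tau>" "tval (NLess (N 0) (NV ''e'')) \<tau>"
    then obtain ds ys where inv: "?inv ds ys \<tau>" and pos: "0 < nvar \<tau> ''e''"
      unfolding tval.simps nval.simps by blast
    let ?e = "nvar \<tau> ''e''" and ?m = "nvar \<tau> ''m''"
    obtain zs where ys: "ys = ?e # zs" using inv pos linked_list_pos by blast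
    have e_arc: "?e \<in> arcs T" "tail T ?e = ?v"
      using set_L inv ys by auto
    have "?e \<notin> set ds" using distinct_out_list[of T "Suc n" ?v] inv ys by auto
    then have e_new: "?e \<notin> ?A \<union> set ds" using v_new e_arc by (simp add: expanded_arcs_def)
    let ?\<rho> = "set_nvar ''m'' (?m + 1)
      (set_rarr ''dist'' (head T ?e) (rarr \<tau> ''dist'' ?v + x ?e)
        (set_narr ''queue'' ?m (head T ?e) \<tau>))"
    have bfs': "bfs_state T n x (insert ?e (?A \<union> set ds)) ?\<rho>"
      using inv e_arc e_new v_disc i by (intro bfs_state_scan_arc) auto
    have acc: "narr \<tau> ''head'' ?e = head T ?e" "rarr \<tau> ''wbar'' = x"
      using inv e_arc by (auto simp: bfs_state_def)
    have "?inv (ds @ [?e]) zs (set_nvar ''e'' (narr \<tau> ''next'' ?e) ?\<rho>)"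
      using inv ys bfs' i by (auto simp: bfs_state_def has_out_lists_def)
    \<comment> \<open>Read off from the state after enqueuing; it makes the potential drop by the
      full 40.\<close>
    moreover have "Suc ?m \<le> Suc n"
      using bfs_state_queue_bound[OF bfs'] by simp
    ultimately show "wp (NStore ''queue'' (NV ''m'') (NA ''head'' (NV ''e'')) ;;
       RStore ''dist'' (NA ''head'' (NV ''e''))
         (RPlus (RA ''dist'' (NV ''v'')) (RA ''wbar'' (NV ''e''))) ;;
       NAssign ''m'' (NPlus (NV ''m'') (N 1)) ;;
       NAssign ''e'' (NA ''next'' (NV ''e'')))
      (\<lambda>t \<tau>'. (\<exists>ds ys. ?inv ds ys \<tau>') \<and> 1 + tcost (NLess (N 0) (NV ''e'')) + t +
         40 * (Suc n - nvar \<tau>' ''m'') \<le> 40 * (Suc n - nvar \<tau> ''m'')) \<tau>"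
      using inv
      by (intro wp_intros conjI, intro exI[of _ "ds @ [?e]"] exI[of _ zs]) (simp_all add: acc)
  next
    fix t :: nat and \<tau> :: state
    assume *: "(\<exists>ds ys. ?inv ds ys \<tau>) \<and> \<not> tval (NLess (N 0) (NV ''e'')) \<tau> \<and>
      t + 40 * (Suc n - nvar \<tau> ''m'')
        \<le> 40 * (Suc n - nvar \<sigma> ''m'') + (1 + tcost (NLess (N 0) (NV ''e'')))"
    then obtain ds ys where inv: "?inv ds ys \<tau>" by blast
    \<comment> \<open>The pointer is null, so nothing of the list remains.\<close>
    then have "ys = []" using * by (cases ys) simp_all
    then have "set ds = {e \<in> arcs T. tail T e = ?v}" using inv set_L by simp
    then show "bfs_state T n x (?A \<union> {e \<in> arcs T. tail T e = ?v}) \<tau> \<and>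
      nvar \<tau> ''i'' = nvar \<sigma> ''i'' \<and> nvar \<sigma> ''m'' \<le> nvar \<tau> ''m'' \<and>
      (\<forall>j\<le>nvar \<sigma> ''i''. narr \<tau> ''queue'' j = narr \<sigma> ''queue'' j) \<and>
      t + 40 * (Suc n - nvar \<tau> ''m'') \<le> 40 * (Suc n - nvar \<sigma> ''m'') + 10"
      using * inv by simp
  qed
qed

text \<open>When the loop ends, all discovered nodes are expanded. They are thus closed under arcs
  and contain every leaf, and \<open>value\<close> is the full sum.\<close>

lemma wp_sum_distances:
  assumes wbar: "rarr \<sigma> ''wbar'' = x" and lists: "has_out_lists T n (Suc n) \<sigma>"
    and head: "\<forall>e\<in>arcs T. narr \<sigma> ''head'' e = head T e"
  shows "wp sum_distances (\<lambda>t \<sigma>'. t \<le> 100 * n + 200 \<and> rarr \<sigma>' ''wbar'' = x \<and>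
           rvar \<sigma>' ''value'' = sum_root_leaf_dist x) \<sigma>"
proof -
  let ?I = "\<lambda>\<sigma>. bfs_state T n x (expanded_arcs T \<sigma>) \<sigma> \<and> nvar \<sigma> ''i'' \<le> nvar \<sigma> ''m''"
  let ?\<Phi> = "\<lambda>\<sigma>. 40 * (Suc n - nvar \<sigma> ''m'') + 60 * (Suc n - nvar \<sigma> ''i'')"
  let ?D = "\<lambda>v. awalk_cost x (root_path v)"
  have step: "wp (NAssign ''v'' (NA ''queue'' (NV ''i'')) ;;
       NAssign ''e'' (NA ''first'' (NV ''v'')) ;;
       (IF NLess (N 0) (NV ''e'') THEN scan_arcs
        ELSE RAssign ''value'' (RPlus (RV ''value'') (RA ''dist'' (NV ''v'')))) ;;
       NAssign ''i'' (NPlus (NV ''i'') (N 1)))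
      (\<lambda>t \<sigma>'. ?I \<sigma>' \<and> 1 + tcost (NLess (NV ''i'') (NV ''m'')) + t + ?\<Phi> \<sigma>' \<le> ?\<Phi> \<sigma>) \<sigma>"
    if "?I \<sigma>" "tval (NLess (NV ''i'') (NV ''m'')) \<sigma>" for \<sigma>
  proof -
    let ?i = "nvar \<sigma> ''i''"
    define v where "v = narr \<sigma> ''queue'' ?i"
    define \<sigma>1 where "\<sigma>1 = set_nvar ''e'' (narr \<sigma> ''first'' v) (set_nvar ''v'' v \<sigma>)"
    have bfs: "bfs_state T n x (expanded_arcs T \<sigma>) \<sigma>" and i: "?i < nvar \<sigma> ''m''"
      using that by auto
    \<comment> \<open>With \<open>i < m\<close> this makes \<open>Suc n - i\<close> drop by exactly
      one, releasing 60 units for the work outside the inner iterations.\<close>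
    have m: "nvar \<sigma> ''m'' \<le> Suc n" using bfs by (rule bfs_state_queue_bound)
    have exp1: "expanded_arcs T \<sigma>1 = expanded_arcs T \<sigma>"
      by (simp add: expanded_arcs_def \<sigma>1_def)
    have bfs1: "bfs_state T n x (expanded_arcs T \<sigma>1) \<sigma>1"
      using bfs unfolding exp1 by (simp add: bfs_state_def has_out_lists_def \<sigma>1_def)
    have v_disc: "v \<in> insert 0 (head T ` expanded_arcs T \<sigma>)"
      using bfs i unfolding v_def bfs_state_def by blast
    then have v_vert: "v \<in> verts T"
      using head_in_verts root_in_verts by (auto simp: expanded_arcs_def)
    have v_new: "v \<notin> narr \<sigma> ''queue'' ` {..<?i}"
      using bfs_state_next_node[OF bfs i] by (simp add: v_def)
    have out: "set (out_list T (Suc n) v) = out_arcs T v"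
      by (auto simp: set_out_list arcs out_arcs_def)
    have list: "linked_list (narr \<sigma> ''next'') (narr \<sigma> ''first'' v) (out_list T (Suc n) v)"
      using bfs v_vert verts by (simp add: bfs_state_def has_out_lists_def)
    \<comment> \<open>Shared by both branches: in \<open>\<tau>'\<close> the arcs out of
      \<open>v\<close> are scanned (none for a leaf), and \<open>\<tau>\<close> adds the distance of
      \<open>v\<close> just if \<open>v\<close> is a leaf.\<close>
    have finish: "?I (set_nvar ''i'' (Suc ?i) \<tau>)"
      if "bfs_state T n x (expanded_arcs T \<sigma> \<union> out_arcs T v) \<tau>'"
        and "\<forall>j\<le>?i. narr \<tau>' ''queue'' j = narr \<sigma> ''queue'' j"
        and "nvar \<tau>' ''i'' = ?i" "nvar \<sigma> ''m'' \<le> nvar \<tau>' ''m''"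
        and "\<tau> = set_rvar ''value''
          (rvar \<tau>' ''value'' + (if out_arcs T v = {} then ?D v else 0)) \<tau>'"
      for \<tau> \<tau>'
    proof -
      have Q0: "narr \<tau>' ''queue'' ` {..<?i} = narr \<sigma> ''queue'' ` {..<?i}"
        by (intro image_cong) (simp_all add: that(2))
      have Q: "narr \<tau>' ''queue'' ` {..<Suc ?i} = insert v (narr \<sigma> ''queue'' ` {..<?i})"
        unfolding lessThan_Suc image_insert Q0 by (simp add: that(2) v_def)
      have "expanded_arcs T (set_nvar ''i'' (Suc ?i) \<tau>) = expanded_arcs T \<sigma> \<union> out_arcs T v"
        unfolding that(5) expanded_arcs_def state_access fun_upd_same Q by auto
      moreover have "v \<in> leaves \<longleftrightarrow> out_arcs T v = {}"
        using v_vert by (simp add: leaves_def)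
      then have "(\<Sum>v \<in> narr \<tau>' ''queue'' ` {..<Suc ?i} \<inter> leaves. ?D v) =
          (\<Sum>v \<in> narr \<tau>' ''queue'' ` {..<?i} \<inter> leaves. ?D v) +
          (if out_arcs T v = {} then ?D v else 0)"
        using v_new unfolding Q Q0 by (simp add: Int_insert_left)
      ultimately show ?thesis
        using that i by (simp add: bfs_state_def has_out_lists_def)
    qed
    have "wp (IF NLess (N 0) (NV ''e'') THEN scan_arcs
        ELSE RAssign ''value'' (RPlus (RV ''value'') (RA ''dist'' (NV ''v''))))
      (\<lambda>t \<tau>. ?I (set_nvar ''i'' (Suc ?i) \<tau>) \<and> nvar \<tau> ''i'' = ?i \<and>
         t + 40 * (Suc n - nvar \<tau> ''m'') \<le> 40 * (Suc n - nvar \<sigma> ''m'') + 30) \<sigma>1"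
    proof (rule wp_If)
      assume "tval (NLess (N 0) (NV ''e'')) \<sigma>1"
      then have nonempty: "out_arcs T v \<noteq> {}"
        using linked_list_pos[OF list] out by (auto simp: \<sigma>1_def)
      have "wp scan_arcs (\<lambda>t \<tau>. bfs_state T n x (expanded_arcs T \<sigma> \<union> out_arcs T v) \<tau> \<and>
          nvar \<tau> ''i'' = ?i \<and> nvar \<sigma> ''m'' \<le> nvar \<tau> ''m'' \<and>
          (\<forall>j\<le>?i. narr \<tau> ''queue'' j = narr \<sigma> ''queue'' j) \<and>
          t + 40 * (Suc n - nvar \<tau> ''m'') \<le> 40 * (Suc n - nvar \<sigma> ''m'') + 10) \<sigma>1"
        using wp_scan_arcs[OF bfs1] i unfolding exp1
        by (simp add: \<sigma>1_def v_def out_arcs_def)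
      then show "wp scan_arcs (\<lambda>t \<tau>. ?I (set_nvar ''i'' (Suc ?i) \<tau>) \<and> nvar \<tau> ''i'' = ?i \<and>
          1 + tcost (NLess (N 0) (NV ''e'')) + t + 40 * (Suc n - nvar \<tau> ''m'')
            \<le> 40 * (Suc n - nvar \<sigma> ''m'') + 30) \<sigma>1"
      proof (rule wp_mono, elim conjE, intro conjI)
        fix t :: nat and \<tau> :: state
        assume *: "bfs_state T n x (expanded_arcs T \<sigma> \<union> out_arcs T v) \<tau>" "nvar \<tau> ''i'' = ?i"
          "nvar \<sigma> ''m'' \<le> nvar \<tau> ''m''" "\<forall>j\<le>?i. narr \<tau> ''queue'' j = narr \<sigma> ''queue'' j"
        \<comment> \<open>An inner node contributes 0, which brings this branch into the form of
          \<open>finish\<close>.\<close>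
        have "\<tau> = set_rvar ''value'' (rvar \<tau> ''value'' + (if out_arcs T v = {} then ?D v else 0)) \<tau>"
          using nonempty by (simp add: set_rvar_def)
        from finish[OF *(1,4,2,3) this]
        show "bfs_state T n x (expanded_arcs T (set_nvar ''i'' (Suc ?i) \<tau>)) (set_nvar ''i'' (Suc ?i) \<tau>)"
          and "nvar (set_nvar ''i'' (Suc ?i) \<tau>) ''i'' \<le> nvar (set_nvar ''i'' (Suc ?i) \<tau>) ''m''"
          by blast+
      qed simp_all
    next
      assume "\<not> tval (NLess (N 0) (NV ''e'')) \<sigma>1"
      then have empty: "out_arcs T v = {}"
        using list out by (cases "out_list T (Suc n) v") (auto simp: \<sigma>1_def)
      have dist: "rarr \<sigma> ''dist'' v = ?D v"
        using bfs v_disc by (auto simp: bfs_state_def)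
      \<comment> \<open>For a leaf there is nothing to scan, so \<open>\<sigma>1\<close> itself
        takes the place of \<open>\<tau>'\<close>.\<close>
      have "?I (set_nvar ''i'' (Suc ?i) (set_rvar ''value'' (rvar \<sigma>1 ''value'' + ?D v) \<sigma>1))"
        using bfs1 exp1 empty by (intro finish[of \<sigma>1]) (auto simp: \<sigma>1_def)
      then show "wp (RAssign ''value'' (RPlus (RV ''value'') (RA ''dist'' (NV ''v''))))
        (\<lambda>t \<tau>. ?I (set_nvar ''i'' (Suc ?i) \<tau>) \<and> nvar \<tau> ''i'' = ?i \<and>
          1 + tcost (NLess (N 0) (NV ''e'')) + t + 40 * (Suc n - nvar \<tau> ''m'')
            \<le> 40 * (Suc n - nvar \<sigma> ''m'') + 30) \<sigma>1"
        by (intro wp_RAssign conjI) (simp_all add: \<sigma>1_def dist)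
    qed
    moreover have start: "set_nvar ''e'' (nval (NA ''first'' (NV ''v''))
        (set_nvar ''v'' (nval (NA ''queue'' (NV ''i'')) \<sigma>) \<sigma>))
        (set_nvar ''v'' (nval (NA ''queue'' (NV ''i'')) \<sigma>) \<sigma>) = \<sigma>1"
      by (simp add: \<sigma>1_def v_def)
    ultimately show ?thesis
      apply (intro wp_Seq wp_NAssign)
      apply (subst start)
      apply (erule wp_mono)
      apply (rule wp_NAssign)
      using i m by (simp add: Suc_diff_le)
  qed
  \<comment> \<open>The state in which the loop starts: the root is enqueued and nothing is
    expanded.\<close>
  define \<sigma>0 where "\<sigma>0 = set_nvar ''m'' 1 (set_nvar ''i'' 0 (set_rarr ''dist'' 0 0
    (set_narr ''queue'' 0 0 (set_rvar ''value'' 0 \<sigma>))))"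
  have init: "?I \<sigma>0"
    using wbar lists head
    by (auto simp: \<sigma>0_def bfs_state_def has_out_lists_def expanded_arcs_def root_path_root inj_on_def)
  have exit: "rvar \<tau> ''value'' = sum_root_leaf_dist x"
    if "?I \<tau>" "\<not> tval (NLess (NV ''i'') (NV ''m'')) \<tau>" for \<tau>
  proof -
    let ?S = "narr \<tau> ''queue'' ` {..<nvar \<tau> ''i''}"
    have bfs: "bfs_state T n x (expanded_arcs T \<tau>) \<tau>" and "nvar \<tau> ''i'' = nvar \<tau> ''m''"
      using that by auto
    then have S: "?S = insert 0 (head T ` expanded_arcs T \<tau>)"
      by (simp add: bfs_state_def)
    have "verts T \<subseteq> ?S"
    proof (rule closed_contains_verts)
      show "0 \<in> ?S" unfolding S by simp
    next
      fix e assume "e \<in> arcs T" "tail T e \<in> ?S"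
      then have "e \<in> expanded_arcs T \<tau>" by (simp add: expanded_arcs_def)
      then show "head T e \<in> ?S" unfolding S by blast
    qed
    then have "?S \<inter> leaves = leaves" by (auto simp: leaves_def)
    then show ?thesis using bfs by (simp add: bfs_state_def sum_root_leaf_dist_def)
  qed
  have "wp (WHILE NLess (NV ''i'') (NV ''m'') DO (
       NAssign ''v'' (NA ''queue'' (NV ''i'')) ;;
       NAssign ''e'' (NA ''first'' (NV ''v'')) ;;
       (IF NLess (N 0) (NV ''e'') THEN scan_arcs
        ELSE RAssign ''value'' (RPlus (RV ''value'') (RA ''dist'' (NV ''v'')))) ;;
       NAssign ''i'' (NPlus (NV ''i'') (N 1))))
      (\<lambda>t \<sigma>'. t \<le> 100 * n + 150 \<and> rarr \<sigma>' ''wbar'' = x \<and>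
         rvar \<sigma>' ''value'' = sum_root_leaf_dist x) \<sigma>0"
    apply (rule wp_mono, rule wp_While[where I = ?I and \<Phi> = ?\<Phi>, OF init step], assumption+)
    subgoal for t \<tau>
      using exit[of \<tau>] by (auto simp: \<sigma>0_def bfs_state_def)
    done
  then show ?thesis
    unfolding sum_distances_def
    apply (intro wp_Seq wp_NAssign wp_NStore wp_RAssign wp_RStore)
    unfolding \<sigma>0_def scan_arcs_def nval.simps rval.simps
    by (erule wp_mono) simp
qed

end

section \<open>Composition of the three phases into a linear-time optimal algorithm\<close>

theorem theorem2:
  shows "\<exists>time :: nat \<Rightarrow> real. time \<in> O(\<lambda>n. real n) \<and>
    (\<forall>(n :: nat) (T :: (nat, nat) pre_digraph) (w :: nat \<Rightarrow> real) (u :: nat \<Rightarrow> real)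
       (c :: nat \<Rightarrow> real) (K :: real) (\<sigma> :: state).
       sdipt_inf T 0 w u c K \<and> sdipt_input n T w u c K \<sigma> \<longrightarrow>
       (\<exists>t \<sigma>'. exec sdipt_algorithm \<sigma> t \<sigma>' \<and> real t \<le> time n \<and>
          (\<forall>e\<in>arcs T. output_weights \<sigma>' e = w e + min (K / c e) (u e - w e)) \<and>
          output_value \<sigma>' = rooted_tree.sum_root_leaf_dist T 0 (output_weights \<sigma>') \<and>
          sdipt_inf.optimal_solution T 0 w u c K (output_weights \<sigma>') \<and>
          output_value \<sigma>' = sdipt_inf.optimal_value T 0 w u c K))"
\<comment> \<open>The sum of the phase bounds \<open>20 * n + 40\<close>, \<open>60 * n + 40\<close>
  and \<open>100 * n + 200\<close>.\<close>
proof (intro exI[of _ "\<lambda>n. real (180 * n + 280)"] conjI allI impI; (elim conjE)?)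
  show "(\<lambda>n. real (180 * n + 280)) \<in> O(\<lambda>n. real n)"
  \<comment> \<open>For \<open>n \<ge> 1\<close> the constant 280 is at most \<open>280 * n\<close>,
    and 460 is 180 + 280.\<close>
  proof (rule landau_o.bigI[of 460])
    show "\<forall>\<^sub>F n in at_top. norm (real (180 * n + 280)) \<le> 460 * norm (real n)"
      using eventually_ge_at_top[of "1 :: nat"] by eventually_elim simp
  qed simp
next
  fix n T w u c K \<sigma>
  assume inst: "sdipt_inf T 0 w u c K" and input: "sdipt_input n T w u c K \<sigma>"
  interpret sdipt_inf T 0 w u c K by (rule inst)
  have VA: "verts T = {0..n}" "arcs T = {1..n}" using input by (auto simp: sdipt_input_def)
  have "wp sdipt_algorithm (\<lambda>t \<sigma>'. t \<le> 180 * n + 280 \<and>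
      (\<forall>e\<in>arcs T. output_weights \<sigma>' e = w e + min (K / c e) (u e - w e)) \<and>
      output_value \<sigma>' = sum_root_leaf_dist (output_weights \<sigma>')) \<sigma>"
    unfolding sdipt_algorithm_def
  proof (rule wp_Seq, rule wp_mono[OF wp_init_lists[OF input]], elim conjE,
      rule wp_Seq, rule wp_mono[OF wp_process_arcs[OF wf_digraph_axioms]], assumption+, elim conjE)
    fix t1 t2 \<sigma>2
    assume t: "t1 \<le> 20 * n + 40" "t2 \<le> 60 * n + 40"
      and input2: "sdipt_input n T w u c K \<sigma>2" and lists: "has_out_lists T n (Suc n) \<sigma>2"
      and wbar: "\<forall>e\<in>{1..n}. rarr \<sigma>2 ''wbar'' e = w e + min (K / c e) (u e - w e)"
    have "\<forall>e\<in>arcs T. narr \<sigma>2 ''head'' e = head T e"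
      using input2 by (simp add: sdipt_input_def)
    \<comment> \<open>\<open>refl\<close> takes the whole array \<open>wbar\<close> as weight
      vector; the search leaves it unchanged, so it is also the output.\<close>
    from wp_sum_distances[OF rooted_tree_axioms VA refl lists this]
    show "wp sum_distances (\<lambda>t3 \<sigma>'. t1 + (t2 + t3) \<le> 180 * n + 280 \<and>
        (\<forall>e\<in>arcs T. output_weights \<sigma>' e = w e + min (K / c e) (u e - w e)) \<and>
        output_value \<sigma>' = sum_root_leaf_dist (output_weights \<sigma>')) \<sigma>2"
      by (rule wp_mono) (use t wbar VA in \<open>auto simp: output_weights_def output_value_def\<close>)
  qed
  then show "\<exists>t \<sigma>'. exec sdipt_algorithm \<sigma> t \<sigma>' \<and> real t \<le> real (180 * n + 280) \<and>
      (\<forall>e\<in>arcs T. output_weights \<sigma>' e = w e + min (K / c e) (u e - w e)) \<and>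
      output_value \<sigma>' = sum_root_leaf_dist (output_weights \<sigma>') \<and>
      optimal_solution (output_weights \<sigma>') \<and> output_value \<sigma>' = optimal_value"
    unfolding wp_def of_nat_le_iff using optimal_solutionI optimal_value_eq by metis
qed

end
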